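(* Let $n\ge 1$ and let $K_n$ denote the complete graph on $n$ vertices. For every integer $\ell$ with $0\le \ell\le n$, $$Z^+_{(\ell)}(K_n) = \begin{cases} n-1 & \text{if } \ell \le n-2,\\ n & \text{if } \ell \ge n-1.\end{cases}$$
   Context: All graphs are finite, simple and undirected. Positive semidefinite (psd) color change rule: given the current set $B$ of blue vertices of a graph $G$, let $W_1,\dots,W_k$ be the vertex sets of the connected components of $G-B$. If $u\in B$ and $w\in W_i$ is the only non-blue neighbor of $u$ in the induced subgraph $G[W_i\cup B]$, then $u$ may force $w$ (written $u\to w$), and $w$ becomes blue. The rule is applied iteratively, with the components recomputed from the current blue set. A leak is a vertex that is not allowed to perform any force. For $0\le \ell\le |V(G)|$, a set $B\subseteq V(G)$ is an $\ell$-leaky positive semidefinite forcing set of $G$ if, for every choice of $\ell$ vertices as leaks (chosen after $B$ is fixed; leaks may be inside or outside $B$), starting with exactly $B$ blue, iterated application of the psd color change rule, with forces performed only by non-leak vertices, colors all of $V(G)$ blue. The $\ell$-leaky positive semidefinite forcing number $Z^+_{(\ell)}(G)$ is the minimum cardinality of an $\ell$-leaky positive semidefinite forcing set of $G$. *)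

theory Defs
  imports "Graph_Theory.Graph_Theory"
begin

text \<open>
  Finite simple undirected graphs are the symmetric digraphs of locale \<^locale>\<open>graph\<close>, and
  \<^term>\<open>complete_digraph n G\<close> says that \<^term>\<open>G\<close> is a complete graph on \<^term>\<open>n\<close> vertices.
  For symmetric digraphs, strong connectivity is connectivity, so the vertex sets of the
  connected components are given by \<^const>\<open>pre_digraph.sccs_verts\<close>.
\<close>

definition psd_force :: "('a, 'b) pre_digraph \<Rightarrow> 'a set \<Rightarrow> 'a \<Rightarrow> 'a \<Rightarrow> bool" where
  "psd_force G B u w \<longleftrightarrow> u \<in> B \<and>
    (\<exists>W \<in> pre_digraph.sccs_verts (G \<restriction> (verts G - B)).
       w \<in> W \<and> {x. x \<notin> B \<and> u \<rightarrow>\<^bsub>G \<restriction> (W \<union> B)\<^esub> x} = {w})"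

definition leaky_psd_step :: "('a, 'b) pre_digraph \<Rightarrow> 'a set \<Rightarrow> 'a set \<Rightarrow> 'a set \<Rightarrow> bool" where
  "leaky_psd_step G L B B' \<longleftrightarrow> (\<exists>u w. u \<notin> L \<and> psd_force G B u w \<and> B' = insert w B)"

text \<open>
  Only meaningful for \<^term>\<open>l \<le> card (verts G)\<close>; for larger \<^term>\<open>l\<close> there is no choice of leaks
  and the condition on \<^term>\<open>L\<close> is vacuous.
\<close>
definition leaky_psd_forcing_set :: "('a, 'b) pre_digraph \<Rightarrow> nat \<Rightarrow> 'a set \<Rightarrow> bool" where
  "leaky_psd_forcing_set G l B \<longleftrightarrow> B \<subseteq> verts G \<and>
    (\<forall>L. L \<subseteq> verts G \<and> card L = l \<longrightarrow> (leaky_psd_step G L)\<^sup>*\<^sup>* B (verts G))"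

definition leaky_psd_forcing_number :: "('a, 'b) pre_digraph \<Rightarrow> nat \<Rightarrow> nat" where
  "leaky_psd_forcing_number G l = (LEAST k. \<exists>B. leaky_psd_forcing_set G l B \<and> card B = k)"

end

theory Submission
  imports Defs
begin

text \<open>
  Removing a blue set from a complete graph leaves at most one component, to which every blue
  vertex is completely joined. So a force is possible only when exactly one vertex is still
  white, and then any blue non-leak vertex can perform it. Hence a set is forcing exactly when
  it misses at most one vertex and, if it misses one, it cannot be covered by the leaks.
\<close>

lemma complete_digraph_wf: "complete_digraph n G \<Longrightarrow> wf_digraph G"
  by (simp add: complete_digraph_def graph_def digraph_def fin_digraph_def)

lemma complete_digraph_finite_verts: "complete_digraph n G \<Longrightarrow> finite (verts G)"
  by (simp add: complete_digraph_def graph_def digraph_def fin_digraph.finite_verts)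

lemma complete_digraph_card_verts: "complete_digraph n G \<Longrightarrow> card (verts G) = n"
  by (simp add: complete_digraph_def)

lemma dominates_induce_subgraph_iff:
  "u \<rightarrow>\<^bsub>G \<restriction> S\<^esub> v \<longleftrightarrow> u \<rightarrow>\<^bsub>G\<^esub> v \<and> u \<in> S \<and> v \<in> S"
  by (auto simp: arcs_ends_def arc_to_ends_def)

lemma complete_digraph_dominates_iff:
  "complete_digraph n G \<Longrightarrow> u \<rightarrow>\<^bsub>G\<^esub> v \<longleftrightarrow> u \<in> verts G \<and> v \<in> verts G \<and> u \<noteq> v"
  by (simp add: complete_digraph_def)

text \<open>Induced subgraphs of a complete graph are complete, so any two of their vertices reach
  each other. The empty case stands apart because components are nonempty.\<close>

lemma complete_digraph_sccs_verts_induce: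
  assumes "complete_digraph n G" and "S \<subseteq> verts G"
  shows "pre_digraph.sccs_verts (G \<restriction> S) = (if S = {} then {} else {S})"
proof -
  interpret G: wf_digraph G using assms(1) by (rule complete_digraph_wf)
  interpret H: wf_digraph "G \<restriction> S" by (rule G.wellformed_induce_subgraph)
  have reach: "u \<rightarrow>\<^sup>*\<^bsub>G \<restriction> S\<^esub> v \<longleftrightarrow> u \<in> S \<and> v \<in> S" for u v
  proof
    assume "u \<rightarrow>\<^sup>*\<^bsub>G \<restriction> S\<^esub> v"
    then show "u \<in> S \<and> v \<in> S"
      using H.reachable_in_verts by fastforce
  next
    assume uv: "u \<in> S \<and> v \<in> S"
    show "u \<rightarrow>\<^sup>*\<^bsub>G \<restriction> S\<^esub> v"
    \<comment> \<open>There are no loops, so an arc joins only distinct vertices; a vertex reaches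
      itself by the empty walk.\<close>
    proof (cases "u = v")
      case False
      with uv assms have "u \<rightarrow>\<^bsub>G \<restriction> S\<^esub> v"
        by (auto simp: dominates_induce_subgraph_iff complete_digraph_dominates_iff)
      then show ?thesis by (rule H.reachable_adjI)
    qed (use uv in auto)
  qed
  show ?thesis
    unfolding H.sccs_verts_def reach by auto
qed

lemma complete_digraph_psd_force_iff:
  assumes "complete_digraph n G" and "B \<subseteq> verts G"
  shows "psd_force G B u w \<longleftrightarrow> u \<in> B \<and> verts G - B = {w}"
proof -
  \<comment> \<open>The only possible component is \<open>W = verts G - B\<close>, so
    \<open>W \<union> B\<close> is the whole vertex set and a blue \<open>u\<close> sees every white
    vertex.\<close>
  have "{x. x \<notin> B \<and> u \<rightarrow>\<^bsub>G \<restriction> (verts G - B \<union> B)\<^esub> x} = verts G - B" if "u \<in> B"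
    using that assms by (auto simp: dominates_induce_subgraph_iff complete_digraph_dominates_iff)
  then show ?thesis
    unfolding psd_force_def complete_digraph_sccs_verts_induce[OF assms(1) Diff_subset]
    by auto
qed

lemma complete_digraph_leaky_psd_step_iff:
  assumes "complete_digraph n G" and "B \<subseteq> verts G"
  shows "leaky_psd_step G L B B' \<longleftrightarrow>
    \<not> B \<subseteq> L \<and> B' = verts G \<and> (\<exists>w. verts G - B = {w})"
proof -
  have "insert w B = verts G" if "verts G - B = {w}" for w
    using that assms(2) by blast
  then show ?thesis
    unfolding leaky_psd_step_def complete_digraph_psd_force_iff[OF assms] by blast
qed

lemma complete_digraph_leaky_psd_steps_iff:
  assumes "complete_digraph n G" and "B \<subseteq> verts G"
  shows "(leaky_psd_step G L)\<^sup>*\<^sup>* B (verts G) \<longleftrightarrow>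
    B = verts G \<or> \<not> B \<subseteq> L \<and> (\<exists>w. verts G - B = {w})"
  \<comment> \<open>Every step from \<open>B\<close> lands on \<open>verts G\<close> at once, so the
    first step of a run decides everything.\<close>
  using complete_digraph_leaky_psd_step_iff[OF assms]
  by (metis converse_rtranclpE rtranclp.rtrancl_refl r_into_rtranclp)

text \<open>The first conclusion gives the lower bound \<open>n - 1\<close>; the second rules out
  proper forcing sets once \<open>l\<close> is at least \<open>n - 1\<close>.\<close>

lemma card_less_leaky_psd_forcing_set:
  assumes G: "complete_digraph n G" and "l \<le> n" and B: "leaky_psd_forcing_set G l B"
    and "B \<noteq> verts G"
  shows "card B = n - 1" and "l < card B"
proof -
  note fin = complete_digraph_finite_verts[OF G] and card = complete_digraph_card_verts[OF G]
  have sub: "B \<subseteq> verts G" using B by (simp add: leaky_psd_forcing_set_def)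
  have forces: "\<not> B \<subseteq> L \<and> (\<exists>w. verts G - B = {w})" if "L \<subseteq> verts G" "card L = l" for L
    using that B \<open>B \<noteq> verts G\<close> complete_digraph_leaky_psd_steps_iff[OF G sub]
    by (simp add: leaky_psd_forcing_set_def)
  \<comment> \<open>Any leak set will do, but one must exist for \<open>forces\<close> to say
    anything; this is where \<open>l \<le> n\<close> enters.\<close>
  obtain L where "L \<subseteq> verts G" "card L = l"
    using \<open>l \<le> n\<close> card by (metis obtain_subset_with_card_n)
  from forces[OF this] obtain w where "verts G - B = {w}" by blast
  then have "card (verts G - B) = 1" by simp
  with sub fin card show cardB: "card B = n - 1"
    by (simp add: card_Diff_subset finite_subset)
  show "l < card B"
  proof (rule ccontr)
    assume "\<not> l < card B"
    \<comment> \<open>With at most \<open>l\<close> blue vertices, \<open>B\<close> extends to an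
      admissible leak set, which blocks every force.\<close>
    with sub fin card \<open>l \<le> n\<close> obtain L where "B \<subseteq> L" "L \<subseteq> verts G" "card L = l"
      by (metis exists_subset_between not_less)
    with forces show False by blast
  qed
qed

lemma leaky_psd_forcing_set_verts: "leaky_psd_forcing_set G l (verts G)"
  by (simp add: leaky_psd_forcing_set_def)

text \<open>The \<open>n - 1\<close> blue vertices outnumber the \<open>l\<close> leaks, so some
  blue non-leak can force \<open>w\<close>.\<close>

lemma leaky_psd_forcing_set_Diff_singleton:
  assumes G: "complete_digraph n G" and "w \<in> verts G" and "l < n - 1"
  shows "leaky_psd_forcing_set G l (verts G - {w})"
proof -
  note fin = complete_digraph_finite_verts[OF G] and card = complete_digraph_card_verts[OF G]
  have "\<not> verts G - {w} \<subseteq> L" if "L \<subseteq> verts G" "card L = l" for L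
  proof
    assume "verts G - {w} \<subseteq> L"
    then have "card (verts G - {w}) \<le> card L"
      using that fin by (meson card_mono finite_subset)
    with that fin card assms show False by simp
  qed
  moreover have "verts G - (verts G - {w}) = {w}" using assms(2) by auto
  ultimately show ?thesis
    by (auto simp: leaky_psd_forcing_set_def complete_digraph_leaky_psd_steps_iff[OF G])
qed

theorem theorem22:
  fixes G :: "('a, 'b) pre_digraph" and n l :: nat
  assumes "n \<ge> 1" and "complete_digraph n G" and "l \<le> n"
  shows "(int l \<le> int n - 2 \<longrightarrow> leaky_psd_forcing_number G l = n - 1) \<and>
         (int l \<ge> int n - 1 \<longrightarrow> leaky_psd_forcing_number G l = n)"
proof (intro conjI impI)
  note card = complete_digraph_card_verts[OF assms(2)]
  note lower = card_less_leaky_psd_forcing_set[OF assms(2,3)]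
  {
    assume "int l \<le> int n - 2"
    \<comment> \<open>Over \<open>int\<close>, \<open>n = 1\<close> makes the assumption false;
      truncated subtraction would admit \<open>l = 0\<close>, although the one-vertex graph needs
      its vertex blue.\<close>
    then have l: "l < n - 1" by linarith
    from card assms(1) obtain w where w: "w \<in> verts G" by fastforce
    show "leaky_psd_forcing_number G l = n - 1"
      unfolding leaky_psd_forcing_number_def
    proof (rule Least_equality)
      show "\<exists>B. leaky_psd_forcing_set G l B \<and> card B = n - 1"
        using leaky_psd_forcing_set_Diff_singleton[OF assms(2) w l] w card by fastforce
      show "n - 1 \<le> k" if "\<exists>B. leaky_psd_forcing_set G l B \<and> card B = k" for k
        using that lower(1) card by (metis diff_le_self order_refl)
    qed
  }
  {
    assume "int l \<ge> int n - 1"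
    then have l: "n - 1 \<le> l" by linarith
    show "leaky_psd_forcing_number G l = n"
      unfolding leaky_psd_forcing_number_def
    proof (rule Least_equality)
      show "\<exists>B. leaky_psd_forcing_set G l B \<and> card B = n"
        using leaky_psd_forcing_set_verts card by blast
      \<comment> \<open>A forcing set other than \<open>verts G\<close> would have more than
        \<open>l\<close> but exactly \<open>n - 1\<close> elements, against
        \<open>n - 1 \<le> l\<close>.\<close>
      show "n \<le> k" if "\<exists>B. leaky_psd_forcing_set G l B \<and> card B = k" for k
        using that lower card l by (metis not_less order_refl)
    qed
  }
qed

end
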